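(* Let $\lambda$ be a nonzero real number and let $Y$ be the exponential random variable with parameter $\alpha>0$, i.e. with density $f(y)=\alpha e^{-\alpha y}$ for $y\ge0$ and $f(y)=0$ for $y<0$. Then, for all integers $n\ge k\ge 0$, $$S_{2}^{Y}(n,k)=\binom{n}{k}(n-1)_{n-k}\frac{1}{\alpha^{n}},\qquad S_{1}^{Y}(n,k)=(-1)^{n-k}\binom{n}{k}(n-1)_{n-k}\alpha^{k},$$ $$S_{2,\lambda}^{Y}(n,k)=\sum_{j=k}^{n}\binom{j}{k}(j-1)_{j-k}\frac{1}{\alpha^{j}}\lambda^{n-j}S_{1}(n,j),$$ $$S_{1,\lambda}^{Y}(n,k)=\sum_{j=k}^{n}\binom{n}{j}(-1)^{n-j}(n-1)_{n-j}\alpha^{j} \lambda^{j-k}S_{2}(j,k).$$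
   Context: Classical notions. $(x)_0=1$, $(x)_n=x(x-1)\cdots(x-n+1)$ for $n\ge1$. $S_2(n,k)$ and $S_1(n,k)$ are the Stirling numbers of the second kind and the (signed) Stirling numbers of the first kind: $\frac{1}{k!}(e^t-1)^k=\sum_{n\ge k}S_2(n,k)\frac{t^n}{n!}$, $\frac{1}{k!}(\log(1+t))^k=\sum_{n\ge k}S_1(n,k)\frac{t^n}{n!}$. For nonzero real $\lambda$: $(x)_{0,\lambda}=1$, $(x)_{n,\lambda}=x(x-\lambda)\cdots(x-(n-1)\lambda)$; $e_\lambda^x(t)=(1+\lambda t)^{x/\lambda}=\sum_{n\ge0}(x)_{n,\lambda}\frac{t^n}{n!}$. Probabilistic versions. For a random variable $Y$ whose moment generating function exists near $0$ and with $E[Y]\ne0$, put $e_Y(t)=E[e^{Yt}]-1=\sum_{n\ge1}E[Y^n]\frac{t^n}{n!}$ and $e_{Y,\lambda}(t)=E[e_\lambda^Y(t)]-1=\sum_{n\ge1}E[(Y)_{n,\lambda}]\frac{t^n}{n!}$ (power series in $t$), and let $\bar e_Y(t)$, $\bar e_{Y,\lambda}(t)$ be their compositional inverses. Then for $k\ge0$: $\frac{1}{k!}(e_Y(t))^k=\sum_{n\ge k}S_2^Y(n,k)\frac{t^n}{n!}$, $\frac{1}{k!}(\bar e_Y(t))^k=\sum_{n\ge k}S_1^Y(n,k)\frac{t^n}{n!}$, $\frac{1}{k!}(e_{Y,\lambda}(t))^k=\sum_{n\ge k}S_{2,\lambda}^Y(n,k)\frac{t^n}{n!}$, $\frac{1}{k!}(\bar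 e_{Y,\lambda}(t))^k=\sum_{n\ge k}S_{1,\lambda}^Y(n,k)\frac{t^n}{n!}$ define the probabilistic (degenerate) Stirling numbers associated with $Y$. *)

theory Defs
  imports
    "HOL-Probability.Probability"
    "HOL-Computational_Algebra.Formal_Power_Series"
    "HOL-Combinatorics.Stirling"
begin

definition falling :: "real \<Rightarrow> nat \<Rightarrow> real" where
  "falling x n = (\<Prod>i<n. x - real i)"

definition deg_falling :: "real \<Rightarrow> real \<Rightarrow> nat \<Rightarrow> real" where
  "deg_falling l x n = (\<Prod>i<n. x - real i * l)"

text \<open>
  The degenerate exponential \<open>(1 + l t) powr (x / l)\<close> as a formal power series in \<open>t\<close>;
  lemma \<open>deg_exp_eq_binomial_series\<close> below relates it to the binomial series.
\<close>
definition deg_exp :: "real \<Rightarrow> real \<Rightarrow> real fps" where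
  "deg_exp l x = Abs_fps (\<lambda>n. deg_falling l x n / fact n)"

text \<open>
  \<open>egf_stirling F n k\<close> is the number \<open>s(n,k)\<close> with
  \<open>F(t)^k / k! = \<Sum>n. s(n,k) t^n / n!\<close>.  All series \<open>F\<close> used here have zero constant
  term, so the terms with \<open>n < k\<close> vanish.
\<close>
definition egf_stirling :: "real fps \<Rightarrow> nat \<Rightarrow> nat \<Rightarrow> real" where
  "egf_stirling F n k = fact n * fps_nth (fps_const (1 / fact k) * F ^ k) n"

definition S2 :: "nat \<Rightarrow> nat \<Rightarrow> real" where
  "S2 = egf_stirling (fps_exp 1 - 1)"

text \<open>\<open>fps_ln 1\<close> is the series of \<open>log (1 + t)\<close>, so these are the signed numbers.\<close>
definition S1 :: "nat \<Rightarrow> nat \<Rightarrow> real" where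
  "S1 = egf_stirling (fps_ln 1)"

text \<open>
  Expectation of a random power series, taken coefficientwise.  It is the intended object
  only if all coefficients are integrable, which holds for the series below when \<open>Y\<close> has
  a moment generating function near \<open>0\<close>.
\<close>
definition fps_expectation :: "'a measure \<Rightarrow> ('a \<Rightarrow> real fps) \<Rightarrow> real fps" where
  "fps_expectation M F = Abs_fps (\<lambda>n. \<integral>w. fps_nth (F w) n \<partial>M)"

text \<open>\<open>fps_exp y\<close> is the series of \<open>exp (y t)\<close>.\<close>
definition e_Y :: "'a measure \<Rightarrow> ('a \<Rightarrow> real) \<Rightarrow> real fps" where
  "e_Y M Y = fps_expectation M (\<lambda>w. fps_exp (Y w)) - 1"

definition e_Y_deg :: "'a measure \<Rightarrow> ('a \<Rightarrow> real) \<Rightarrow> real \<Rightarrow> real fps" where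
  "e_Y_deg M Y l = fps_expectation M (\<lambda>w. deg_exp l (Y w)) - 1"

text \<open>
  \<open>fps_inv\<close> is the compositional inverse (whereas \<open>inverse\<close> is the multiplicative one);
  it is meaningful since the linear coefficient of both series is the mean of \<open>Y\<close>,
  which is assumed to be nonzero.
\<close>
definition S2_Y :: "'a measure \<Rightarrow> ('a \<Rightarrow> real) \<Rightarrow> nat \<Rightarrow> nat \<Rightarrow> real" where
  "S2_Y M Y = egf_stirling (e_Y M Y)"

definition S1_Y :: "'a measure \<Rightarrow> ('a \<Rightarrow> real) \<Rightarrow> nat \<Rightarrow> nat \<Rightarrow> real" where
  "S1_Y M Y = egf_stirling (fps_inv (e_Y M Y))"

definition S2_Y_deg :: "'a measure \<Rightarrow> ('a \<Rightarrow> real) \<Rightarrow> real \<Rightarrow> nat \<Rightarrow> nat \<Rightarrow> real" where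
  "S2_Y_deg M Y l = egf_stirling (e_Y_deg M Y l)"

definition S1_Y_deg :: "'a measure \<Rightarrow> ('a \<Rightarrow> real) \<Rightarrow> real \<Rightarrow> nat \<Rightarrow> nat \<Rightarrow> real" where
  "S1_Y_deg M Y l = egf_stirling (fps_inv (e_Y_deg M Y l))"

lemma deg_exp_eq_binomial_series:
  assumes "l \<noteq> 0"
  shows "deg_exp l x = fps_binomial (x / l) oo (fps_const l * fps_X)"
proof (rule fps_ext)
  fix n
  have "(\<Prod>i<n. x - real i * l) = (\<Prod>i<n. l * (x / l - real i))"
    using assms by (intro prod.cong) (auto simp: field_simps)
  also have "\<dots> = l ^ n * (\<Prod>i<n. x / l - real i)"
    by (simp add: prod.distrib)
  finally show "fps_nth (deg_exp l x) n = fps_nth (fps_binomial (x / l) oo (fps_const l * fps_X)) n"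
    by (simp add: deg_exp_def deg_falling_def fps_compose_linear gbinomial_prod_rev
        lessThan_atLeast0)
qed

lemma e_Y_nth:
  assumes "prob_space M"
  shows "fps_nth (e_Y M Y) n = (if n = 0 then 0 else (\<integral>w. Y w ^ n \<partial>M) / fact n)"
  using assms by (simp add: e_Y_def fps_expectation_def prob_space.prob_space)

lemma e_Y_deg_nth:
  assumes "prob_space M"
  shows "fps_nth (e_Y_deg M Y l) n =
    (if n = 0 then 0 else (\<integral>w. deg_falling l (Y w) n \<partial>M) / fact n)"
  using assms
  by (simp add: e_Y_deg_def fps_expectation_def deg_exp_def deg_falling_def prob_space.prob_space)

lemma fps_nth_power_div_fact:
  "fps_nth (fps_const (1 / fact k) * F ^ k) n = egf_stirling F n k / fact n"
  by (simp add: egf_stirling_def)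

lemma fps_nth_deriv_power_div_fact:
  "fps_nth (fps_deriv (fps_const (1 / fact k) * F ^ k)) n = egf_stirling F (Suc n) k / fact n"
  by (simp only: fps_deriv_nth fps_nth_power_div_fact) (simp add: divide_simps)

lemma S2_eq_Stirling: "S2 n k = real (Stirling n k)"
proof (induction n k rule: Stirling.induct)
  case 1
  show ?case by (simp add: S2_def egf_stirling_def)
next
  case (2 k)
  show ?case by (simp add: S2_def egf_stirling_def)
next
  case (3 n)
  show ?case by (simp add: S2_def egf_stirling_def)
next
  case (4 n k)
  let ?F = "fps_exp 1 - 1 :: real fps"
  let ?f = "\<lambda>k. fps_const (1 / fact k) * ?F ^ k"
  have "fps_deriv (?f (Suc k)) = fps_const (1 / fact (Suc k)) * (of_nat (Suc k) * ?F ^ k * (?F + 1))"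
    by (simp add: fps_deriv_power fps_of_nat[symmetric] algebra_simps del: fact_Suc of_nat_Suc power_Suc)
  also have "\<dots> = fps_const (1 / fact (Suc k)) * of_nat (Suc k) * ?F ^ k
      + of_nat (Suc k) * ?f (Suc k)"
    by (simp add: algebra_simps del: fact_Suc of_nat_Suc)
  also have "fps_const (1 / fact (Suc k)) * of_nat (Suc k) = fps_const (1 / fact k :: real)"
    by (simp add: fps_of_nat[symmetric] del: of_nat_Suc)
  finally have "fps_nth (fps_deriv (?f (Suc k))) n
      = fps_nth (?f k) n + real (Suc k) * fps_nth (?f (Suc k)) n"
    by (simp add: fps_of_nat[symmetric] del: of_nat_Suc fact_Suc)
  then have "S2 (Suc n) (Suc k) = real (Suc k) * S2 n (Suc k) + S2 n k"
    unfolding S2_def fps_nth_deriv_power_div_fact fps_nth_power_div_fact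
    by (simp add: field_simps)
  with 4 show ?case by (simp add: algebra_simps)
qed

lemma S1_eq_stirling: "S1 n k = (- 1) ^ (n + k) * real (stirling n k)"
proof (induction n k rule: stirling.induct)
  case 1
  show ?case by (simp add: S1_def egf_stirling_def)
next
  case (2 k)
  show ?case by (simp add: S1_def egf_stirling_def)
next
  case (3 n)
  show ?case by (simp add: S1_def egf_stirling_def)
next
  case (4 n k)
  let ?F = "fps_ln 1 :: real fps"
  let ?f = "\<lambda>k. fps_const (1 / fact k) * ?F ^ k"
  have "(1 + fps_X) * fps_deriv ?F = 1"
    using inverse_mult_eq_1'[of "1 + fps_X :: real fps"] by (simp add: fps_ln_deriv fps_divide_unit)
  moreover have "fps_deriv (?f (Suc k)) =
      fps_const (1 / fact (Suc k)) * of_nat (Suc k) * ?F ^ k * fps_deriv ?F"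
    by (simp add: fps_deriv_power fps_of_nat[symmetric] mult_ac del: fact_Suc of_nat_Suc power_Suc)
  moreover have "fps_const (1 / fact (Suc k)) * of_nat (Suc k) = fps_const (1 / fact k :: real)"
    by (simp add: fps_of_nat[symmetric] del: of_nat_Suc)
  ultimately have "(1 + fps_X) * fps_deriv (?f (Suc k)) = ?f k"
    by (simp add: mult_ac del: fact_Suc of_nat_Suc)
  then have "fps_nth (fps_deriv (?f (Suc k))) n + fps_nth (fps_X * fps_deriv (?f (Suc k))) n
      = fps_nth (?f k) n"
    by (metis distrib_right fps_add_nth mult_1)
  moreover have "fps_nth (fps_X * fps_deriv (?f (Suc k))) n = real n * fps_nth (?f (Suc k)) n"
    by (cases n) (simp_all only: fps_X_mult_nth fps_deriv_nth, simp_all)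
  ultimately have "S1 (Suc n) (Suc k) + real n * S1 n (Suc k) = S1 n k"
    unfolding S1_def fps_nth_deriv_power_div_fact fps_nth_power_div_fact
    by (simp add: field_simps)
  with 4 show ?case by (simp add: algebra_simps)
qed

end

theory Submission
  imports Defs
begin

text \<open>
  The moments \<open>E[Y^n] = n! / \<alpha>^n\<close> make \<open>e_Y\<close> a geometric series:
  \<open>e_Y(t) = t / (\<alpha> - t)\<close>.  This is a fractional linear map fixing \<open>0\<close>, so its
  compositional inverse \<open>\<alpha> t / (1 + t)\<close> is of the same shape, and one
  computation of the coefficients of \<open>(a t / (1 - b t))^k\<close>
  (\<open>egf_stirling_moebius\<close>, by the negative binomial series) yields both
  \<open>S\<^sub>2\<^sup>Y\<close> and \<open>S\<^sub>1\<^sup>Y\<close>; up to powers of \<open>\<alpha>\<close> and signs they are Lah numbers.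

  The degenerate numbers reduce to these by substitution.  From
  \<open>(1 + lam t)^(y / lam) = exp (y log (1 + lam t) / lam)\<close> one gets, on taking expectations
  coefficientwise, \<open>e_Y_deg = e_Y oo D\<close> with \<open>D(t) = log (1 + lam t) / lam\<close>
  (\<open>e_Y_deg_eq_compose\<close>).  Hence the inverse of \<open>e_Y_deg\<close> is the inverse of \<open>e_Y\<close>
  followed by that of \<open>D\<close>, which is \<open>(exp (lam t) - 1) / lam\<close>
  (\<open>fps_inv_compose_deg_log\<close>).  Composition of series multiplies the associated
  triangular arrays (\<open>egf_stirling_compose\<close>), and the arrays of \<open>D\<close> and of its inverse
  are those of \<open>S1\<close> and \<open>S2\<close> with powers of \<open>lam\<close>; this gives the two sums.
\<close>

section \<open>Coefficients of powers under scaling and composition\<close>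

lemma egf_stirling_const_mult:
  "egf_stirling (fps_const c * F) n k = c ^ k * egf_stirling F n k"
  by (simp add: egf_stirling_def power_mult_distrib fps_const_power)

lemma egf_stirling_rescale:
  "egf_stirling (F oo (fps_const c * fps_X)) n k = c ^ n * egf_stirling F n k"
proof -
  have "(F oo (fps_const c * fps_X)) ^ k = F ^ k oo (fps_const c * fps_X)"
    by (rule fps_compose_power) simp
  then show ?thesis
    by (simp add: egf_stirling_def fps_compose_linear)
qed

lemma egf_stirling_eq_0:
  assumes "fps_nth F 0 = 0" "n < k"
  shows "egf_stirling F n k = 0"
  using startsby_zero_power_prefix[OF assms(1)] assms(2) by (simp add: egf_stirling_def)

text \<open>
  The product rule for iteration matrices: expanding \<open>F^k / k!\<close> in powers of its
  argument and substituting \<open>G\<close> replaces \<open>t^j / j!\<close> by \<open>G^j / j!\<close>.  The sum may start at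
  \<open>k\<close> because \<open>F^k\<close> has no terms of lower degree.
\<close>
lemma egf_stirling_compose:
  assumes "fps_nth F 0 = 0" "fps_nth G 0 = 0"
  shows "egf_stirling (F oo G) n k = (\<Sum>j = k..n. egf_stirling F j k * egf_stirling G n j)"
proof -
  have "egf_stirling (F oo G) n k = (\<Sum>j = 0..n. egf_stirling F j k * egf_stirling G n j)"
    by (simp add: egf_stirling_def fps_compose_power[OF assms(2)] fps_compose_nth
        sum_distrib_left sum_divide_distrib mult_ac)
  also have "\<dots> = (\<Sum>j = k..n. egf_stirling F j k * egf_stirling G n j)"
    using egf_stirling_eq_0[OF assms(1)] by (intro sum.mono_neutral_right) auto
  finally show ?thesis .
qed

lemma fps_inv_eqI:
  fixes F G :: "'a::field fps"
  assumes "fps_nth F 0 = 0" "fps_nth F 1 \<noteq> 0" "fps_nth G 0 = 0" "F oo G = fps_X"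
  shows "fps_inv F = G"
proof -
  have "fps_inv F = fps_inv F oo (F oo G)"
    using assms(4) by simp
  also have "\<dots> = (fps_inv F oo F) oo G"
    using assms(1,3) by (intro fps_compose_assoc)
  also have "\<dots> = G"
    using assms by (simp add: fps_inv)
  finally show ?thesis .
qed

section \<open>Fractional linear series fixing the origin\<close>

definition moebius :: "real \<Rightarrow> real \<Rightarrow> real fps" where
  "moebius a b = fps_const a * fps_X * inverse (1 - fps_const b * fps_X)"

lemma moebius_mult: "moebius a b * (1 - fps_const b * fps_X) = fps_const a * fps_X"
  by (simp add: moebius_def mult.assoc inverse_mult_eq_1)

lemma moebius_nth: "fps_nth (moebius a b) n = (if n = 0 then 0 else a * b ^ (n - 1))"
  using one_minus_const_fps_X_neg_power'[of 1 b]
  by (simp add: moebius_def mult.assoc)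

lemma falling_of_nat: "falling (real m) i = fact i * real (m choose i)"
  by (simp add: falling_def binomial_gbinomial gbinomial_prod_rev lessThan_atLeast0)

text \<open>
  The coefficient of \<open>t^n\<close> in \<open>(a t)^k (1 - b t)^(-k)\<close> is
  \<open>a^k b^(n - k)\<close> times \<open>(n - 1) choose (n - k)\<close>; the factor \<open>n! / k!\<close> turns this into a
  product of a binomial coefficient and a falling factorial.
\<close>
lemma egf_stirling_moebius:
  assumes "k \<le> n"
  shows "egf_stirling (moebius a b) n k =
    real (n choose k) * falling (real n - 1) (n - k) * a ^ k * b ^ (n - k)"
proof (cases "k = 0")
  \<comment> \<open>The negative binomial series with natural coefficients needs a positive exponent. For
    \<open>k = 0\<close> the formula holds because \<open>n - 1\<close> is a root of the falling factorial of length
    \<open>n\<close> when \<open>n > 0\<close>, while for \<open>n = 0\<close> the product is empty despite its argument \<open>-1\<close>.\<close>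
  case True
  have "falling (real n - 1) n = 0" if "n > 0"
    using that by (auto simp: falling_def of_nat_diff intro!: bexI[of _ "n - 1"])
  with True show ?thesis
    by (cases "n = 0") (simp_all add: egf_stirling_def falling_def)
next
  case False
  have "fps_nth (moebius a b ^ k) n =
      a ^ k * fps_nth (fps_X ^ k * inverse ((1 - fps_const b * fps_X) ^ k)) n"
    by (simp add: moebius_def power_mult_distrib fps_const_power fps_inverse_power mult.assoc)
  also have "\<dots> = a ^ k * (real ((n - 1) choose (n - k)) * b ^ (n - k))"
    using False assms
    by (simp add: one_minus_const_fps_X_neg_power' fps_X_power_mult_nth)
  finally have "egf_stirling (moebius a b) n k =
      fact n / fact k * real ((n - 1) choose (n - k)) * a ^ k * b ^ (n - k)"
    by (simp add: egf_stirling_def)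
  also have "fact n / fact k = real (n choose k) * fact (n - k)"
    using assms by (simp add: binomial_fact)
  finally show ?thesis
    using False assms falling_of_nat[of "n - 1" "n - k"] by (simp add: of_nat_diff)
qed

text \<open>Solving \<open>s = a t / (1 - b t)\<close> for \<open>t\<close> gives \<open>t = (s / a) / (1 + (b / a) s)\<close>.\<close>
lemma fps_inv_moebius:
  assumes "a \<noteq> 0"
  shows "fps_inv (moebius a b) = moebius (1 / a) (- b / a)"
proof (rule fps_inv_eqI)
  let ?H = "moebius (1 / a) (- b / a)"
  let ?C = "moebius a b oo ?H"
  let ?D = "1 - fps_const (- b / a) * fps_X :: real fps"
  have H0: "fps_nth ?H 0 = 0" by (simp add: moebius_nth)
  \<comment> \<open>Substitute \<open>?H\<close> into the defining equation of the outer series, then clear the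
    denominator \<open>?D\<close> of \<open>?H\<close>; the factor multiplying \<open>?C\<close> collapses to \<open>1\<close>.\<close>
  have "?C * (1 - fps_const b * ?H) = fps_const a * ?H"
    using arg_cong[OF moebius_mult[of a b], of "\<lambda>F. F oo ?H"] H0
    by (simp add: fps_compose_mult_distrib fps_compose_sub_distrib)
  then have "?C * (1 - fps_const b * ?H) * ?D = fps_const a * ?H * ?D"
    by simp
  then have "?C * (?D - fps_const b * (?H * ?D)) = fps_const a * (?H * ?D)"
    by (simp add: algebra_simps)
  moreover have "?D - fps_const b * (fps_const (1 / a) * fps_X) = 1"
    by (rule fps_ext) simp
  moreover have "fps_const a * (fps_const (1 / a) * fps_X) = (fps_X :: real fps)"
    using assms by (simp add: mult.assoc[symmetric])
  ultimately show "?C = fps_X"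
    by (simp only: moebius_mult) simp
qed (use assms in \<open>simp_all add: moebius_nth\<close>)

section \<open>The degenerate exponential\<close>

text \<open>
  The series \<open>log (1 + l t) / l\<close>, for nonzero \<open>l\<close> the compositional inverse of
  \<open>(exp (l t) - 1) / l\<close>.
  Rescaling \<open>fps_ln 1\<close> rather than using the constant argument of \<open>fps_ln\<close> ties its
  coefficients directly to \<open>S1\<close>.
\<close>
definition deg_log :: "real \<Rightarrow> real fps" where
  "deg_log l = fps_const (1 / l) * (fps_ln 1 oo (fps_const l * fps_X))"

lemma deg_log_nth_0 [simp]: "fps_nth (deg_log l) 0 = 0"
  by (simp add: deg_log_def)

lemma egf_stirling_deg_log:
  "egf_stirling (deg_log l) n k = (1 / l) ^ k * l ^ n * S1 n k"
  by (simp only: deg_log_def egf_stirling_const_mult egf_stirling_rescale S1_def mult.assoc)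

text \<open>
  \<open>(1 + t)^c = exp (c log (1 + t))\<close>: both sides have constant term \<open>1\<close> and solve
  \<open>(1 + t) f' = c f\<close>.
\<close>
lemma fps_binomial_eq_exp_ln: "fps_binomial c = fps_exp c oo fps_ln (1 :: 'a::field_char_0)"
proof -
  have "fps_deriv (fps_exp c oo fps_ln 1) =
      fps_const c * (fps_exp c oo fps_ln 1) / (1 + fps_X)"
    by (simp add: fps_compose_deriv fps_ln_deriv fps_compose_mult_distrib fps_divide_unit)
  then show ?thesis
    by (intro fps_binomial_ODE_unique'[THEN iffD1, symmetric]) simp
qed

lemma deg_exp_eq_exp_deg_log:
  assumes "l \<noteq> 0"
  shows "deg_exp l x = fps_exp x oo deg_log l"
proof -
  let ?L = "fps_ln 1 oo (fps_const l * fps_X) :: real fps"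
  have "fps_exp x oo deg_log l = fps_exp x oo ((fps_const (1 / l) * fps_X) oo ?L)"
    by (simp add: deg_log_def fps_compose_mult_distrib)
  also have "\<dots> = (fps_exp x oo (fps_const (1 / l) * fps_X)) oo ?L"
    by (simp add: fps_compose_assoc)
  also have "\<dots> = fps_exp (x / l) oo ?L"
    by (simp add: fps_exp_compose_linear)
  also have "\<dots> = (fps_exp (x / l) oo fps_ln 1) oo (fps_const l * fps_X)"
    by (simp add: fps_compose_assoc)
  finally show ?thesis
    using assms by (simp add: deg_exp_eq_binomial_series fps_binomial_eq_exp_ln)
qed

text \<open>
  Each coefficient of a composition with a deterministic inner series is a finite linear
  combination of coefficients of the outer one, so the integral acts on it by linearity.
\<close>
lemma fps_expectation_compose:
  assumes "\<And>i. integrable M (\<lambda>w. fps_nth (F w) i)"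
  shows "fps_expectation M (\<lambda>w. F w oo G) = fps_expectation M F oo G"
  using assms by (intro fps_ext) (simp add: fps_expectation_def fps_compose_nth)

lemma e_Y_deg_eq_compose:
  assumes "l \<noteq> 0" "\<And>i. integrable M (\<lambda>w. Y w ^ i)"
  shows "e_Y_deg M Y l = e_Y M Y oo deg_log l"
  using assms
  by (simp add: e_Y_deg_def e_Y_def deg_exp_eq_exp_deg_log fps_expectation_compose
      fps_compose_sub_distrib)

text \<open>
  The inverse of a composition is the composition of the inverses in reverse order, and
  \<open>deg_log l\<close> is inverted by \<open>(exp (l t) - 1) / l\<close>.  The exponential
  is written as \<open>fps_exp 1 - 1\<close> at the argument \<open>l t\<close>, the series that defines \<open>S2\<close>.
\<close>
lemma fps_inv_compose_deg_log:
  assumes "l \<noteq> 0" "fps_nth F 0 = 0" "fps_nth F 1 \<noteq> 0"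
  shows "fps_inv (F oo deg_log l) =
    fps_const (1 / l) * ((fps_exp 1 - 1) oo (fps_const l * fps_inv F))"
proof (rule fps_inv_eqI)
  let ?E = "fps_exp 1 - 1 :: real fps"
  let ?A = "fps_const l * fps_inv F"
  let ?G = "fps_const (1 / l) * (?E oo ?A)"
  have inv0: "fps_nth (fps_inv F) 0 = 0"
    by (simp add: fps_inv_def)
  have ln_exp: "fps_ln 1 oo ?E = fps_X"
    by (simp add: fps_ln_fps_exp_inv fps_inv_fps_exp_compose)
  have lG: "fps_const l * ?G = ?E oo ?A"
    using assms(1) by (simp add: mult.assoc[symmetric])
  show G0: "fps_nth ?G 0 = 0"
    by simp
  have "deg_log l oo ?G = fps_const (1 / l) * ((fps_ln 1 oo (fps_const l * fps_X)) oo ?G)"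
    using G0 by (simp add: deg_log_def fps_compose_mult_distrib)
  also have "(fps_ln 1 oo (fps_const l * fps_X)) oo ?G = fps_ln 1 oo ((fps_const l * fps_X) oo ?G)"
    using G0 by (intro fps_compose_assoc[symmetric]) simp_all
  also have "(fps_const l * fps_X) oo ?G = fps_const l * ?G"
    using G0 by (simp add: fps_compose_mult_distrib)
  also have "fps_const l * ?G = ?E oo ?A"
    by (rule lG)
  also have "fps_ln 1 oo (?E oo ?A) = ?A"
    using inv0 ln_exp by (simp add: fps_compose_assoc)
  also have "fps_const (1 / l) * ?A = fps_inv F"
    using assms(1) by (simp add: mult.assoc[symmetric])
  finally have "deg_log l oo ?G = fps_inv F" .
  moreover have "(F oo deg_log l) oo ?G = F oo (deg_log l oo ?G)"
    using G0 by (simp add: fps_compose_assoc)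
  ultimately show "(F oo deg_log l) oo ?G = fps_X"
    using assms by (simp add: fps_inv_right)
  show "fps_nth (F oo deg_log l) 1 \<noteq> 0"
    using assms by (simp add: fps_compose_nth deg_log_def fps_compose_linear fps_ln_nth)
qed (use assms in simp)

section \<open>The exponential distribution\<close>

lemma e_Y_exponential:
  assumes "prob_space M" "\<alpha> > 0" "distributed M lborel Y (exponential_density \<alpha>)"
  shows "e_Y M Y = moebius (1 / \<alpha>) (1 / \<alpha>)"
proof (rule fps_ext)
  fix n
  have "(\<integral>w. Y w ^ n \<partial>M) = fact n / \<alpha> ^ n"
    using prob_space.erlang_ith_moment[OF assms(1,2,3), of n] by simp
  then show "fps_nth (e_Y M Y) n = fps_nth (moebius (1 / \<alpha>) (1 / \<alpha>)) n"
    using assms(1) by (cases n) (simp_all add: e_Y_nth moebius_nth power_one_over)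
qed

theorem theorem2p5:
  fixes M :: "'a measure" and Y :: "'a \<Rightarrow> real" and \<alpha> lam :: real and n k :: nat
  assumes "prob_space M"
    and "\<alpha> > 0"
    and "lam \<noteq> 0"
    and "distributed M lborel Y (exponential_density \<alpha>)"
    and "k \<le> n"
  shows
    "S2_Y M Y n k = real (n choose k) * falling (real n - 1) (n - k) * (1 / \<alpha> ^ n)
     \<and> S1_Y M Y n k = (- 1) ^ (n - k) * real (n choose k) * falling (real n - 1) (n - k) * \<alpha> ^ k
     \<and> S2_Y_deg M Y lam n k =
         (\<Sum>j = k..n. real (j choose k) * falling (real j - 1) (j - k) * (1 / \<alpha> ^ j)
                      * lam ^ (n - j) * S1 n j)
     \<and> S1_Y_deg M Y lam n k =
         (\<Sum>j = k..n. real (n choose j) * (- 1) ^ (n - j) * falling (real n - 1) (n - j)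
                      * \<alpha> ^ j * lam ^ (j - k) * S2 j k)"
proof -
  let ?F = "moebius (1 / \<alpha>) (1 / \<alpha>)"
  have e: "e_Y M Y = ?F"
    using assms by (intro e_Y_exponential)
  have F0: "fps_nth ?F 0 = 0" and F1: "fps_nth ?F 1 \<noteq> 0"
    using assms(2) by (simp_all add: moebius_nth)
  have inv: "fps_inv ?F = moebius \<alpha> (- 1)"
    using assms(2) by (simp add: fps_inv_moebius)
  have deg: "e_Y_deg M Y lam = ?F oo deg_log lam"
    unfolding e[symmetric]
    using assms prob_space.erlang_ith_moment_integrable by (intro e_Y_deg_eq_compose) blast+

  have S2: "egf_stirling ?F m i = real (m choose i) * falling (real m - 1) (m - i) * (1 / \<alpha> ^ m)"
    if "i \<le> m" for m i
    using that assms(2)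
    by (simp add: egf_stirling_moebius power_one_over mult.assoc flip: power_add)
  have S1: "egf_stirling (moebius \<alpha> (- 1)) m i =
      (- 1) ^ (m - i) * real (m choose i) * falling (real m - 1) (m - i) * \<alpha> ^ i"
    if "i \<le> m" for m i
    using that by (simp add: egf_stirling_moebius)

  have "S2_Y_deg M Y lam n k =
      (\<Sum>j = k..n. egf_stirling ?F j k * ((1 / lam) ^ j * lam ^ n * S1 n j))"
    unfolding S2_Y_deg_def deg
    by (simp only: egf_stirling_compose[OF F0 deg_log_nth_0] egf_stirling_deg_log)
  also have "\<dots> = (\<Sum>j = k..n. real (j choose k) * falling (real j - 1) (j - k) * (1 / \<alpha> ^ j)
                      * lam ^ (n - j) * S1 n j)"
    using assms(3) by (intro sum.cong) (simp_all add: S2 power_diff power_one_over)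
  finally have 3: "S2_Y_deg M Y lam n k = \<dots>" .

  have "S1_Y_deg M Y lam n k = (1 / lam) ^ k *
      (\<Sum>j = k..n. S2 j k * (lam ^ j * egf_stirling (moebius \<alpha> (- 1)) n j))"
    unfolding S1_Y_deg_def deg fps_inv_compose_deg_log[OF assms(3) F0 F1] inv
    by (simp add: egf_stirling_const_mult egf_stirling_compose moebius_nth S2_def)
  also have "\<dots> = (\<Sum>j = k..n. real (n choose j) * (- 1) ^ (n - j) * falling (real n - 1) (n - j)
                      * \<alpha> ^ j * lam ^ (j - k) * S2 j k)"
    unfolding sum_distrib_left
    using assms(3) by (intro sum.cong) (simp_all add: S1 power_diff divide_inverse power_inverse mult_ac)
  finally have 4: "S1_Y_deg M Y lam n k = \<dots>" .

  show ?thesis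
    using 3 4 S2[OF assms(5)] S1[OF assms(5)] by (simp only: S2_Y_def S1_Y_def e inv)
qed

end
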